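(* Let $\mathcal{M}$ be a Riemannian homogeneous space with isometry group $G = I(\mathcal{M})$ acting transitively on it. Let $X$ be either $\mathcal{M}$ or $G$, let $S = L^2(X,\mathbf{R})$ and $U = L^2(G,\mathbf{R})$, and let $F : S \to U$ be a non-linear $G$-equivariant function which can be written as $F = \sum_{i\in I} F_i$ for some index set $I$, where each $F_i$ is a product of two linear functions, i.e. $F_i = F_{i,1}F_{i,2}$ with $F_{i,1}, F_{i,2} : S \to U$ linear, the product being the pointwise product $(F_i(f))(g) = (F_{i,1}(f))(g)\,(F_{i,2}(f))(g)$. Then there exist kernels $\{w_i\}_{i\in I} \subset L^2(X\times X,\mathbf{R})$ such that $$(F(f))(g) = \sum_{i\in I} (f\star_2 w_i)(g)$$ for all $f\in S$ and all $g\in G$.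
   Context: Standing assumptions: $\mathcal{M}$ is a Riemannian manifold on which its isometry group $G = I(\mathcal{M})$ acts transitively (a Riemannian homogeneous space), and $G$ is a locally compact topological group. $\omega^{\mathcal{M}}$ denotes the Riemannian volume of $\mathcal{M}$ (which is invariant under $G$), and $\mu_G$ the (left) Haar measure on $G$, so $\mu_G(gA)=\mu_G(A)$. $L^2$ spaces are spaces of real-valued square-integrable functions with respect to these measures (and their products). Action on functions: for $X = \mathcal{M}$ or $X = G$ (with $G$ acting on itself by left multiplication), $g\in G$ and $h : X \to \mathbf{R}$, set $(g\cdot h)(x) = h(g^{-1}\cdot x)$; for $w : X^2 \to \mathbf{R}$, set $(g\cdot w)(x_1,x_2) = w(g^{-1}\cdot x_1,g^{-1}\cdot x_2)$. $F$ is $G$-equivariant if $F(g\cdot f) = g\cdot F(f)$ for all $g\in G$, $f\in S$. Second order correlation: for $f:\mathcal{M}\to\mathbf{R}$ and $w:\mathcal{M}^2\to\mathbf{R}$, $f\star_2 w : G\to\mathbf{R}$ is $(f\star_2 w)(g) = \int_{\mathcal{M}}\int_{\mathcal{M}} f(x_1)f(x_2)\,(g\cdot w)(x_1,x_2)\,\omega^{\mathcal{M}}(x_1)\,\omega^{\mathcal{M}}(x_2)$; for $f:G\to\mathbf{R}$ and $w:G^2\to\mathbf{R}$, $(f\star_2 w)(g) = \int_{G}\int_{G} f(h_1)f(h_2)\,(g\cdot w)(h_1,h_2)\,\mu_G(h_1)\,\mu_G(h_2)$. Sums over $I$ are understood pointwise on $G$.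
   Formalization: The linear maps F_{i,1}, F_{i,2} are additionally assumed to have bounded evaluations f ↦ (F_{i,j}(f))(g) on S for each g in G; without this the claim fails, e.g. for F(f) = f·∫f on G = O(2). Manifolds have dimension at least 1. *)

theory Defs
  imports "HOL-Analysis.Analysis" "HOL-Algebra.Group"
begin

subsection \<open>Smooth manifolds\<close>

primrec Ck_on :: "nat \<Rightarrow> 'a::real_normed_vector set \<Rightarrow> ('a \<Rightarrow> 'b::real_normed_vector) \<Rightarrow> bool" where
  "Ck_on 0 S f \<longleftrightarrow> continuous_on S f"
| "Ck_on (Suc k) S f \<longleftrightarrow>
     (\<forall>x\<in>S. f differentiable (at x)) \<and>
     (\<forall>v. Ck_on k S (\<lambda>x. frechet_derivative f (at x) v))"

(* Only meaningful for open S, which is the only way it is used. *)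
definition smooth_on :: "'a::real_normed_vector set \<Rightarrow> ('a \<Rightarrow> 'b::real_normed_vector) \<Rightarrow> bool" where
  "smooth_on S f \<longleftrightarrow> (\<forall>k. Ck_on k S f)"

(* A chart is its domain together with a map that only matters on that domain. *)
type_synonym ('m, 'n) chart = "'m set \<times> ('m \<Rightarrow> real ^ 'n)"

definition chart_dom :: "('m, 'n) chart \<Rightarrow> 'm set" where
  "chart_dom c = fst c"

definition chart_fun :: "('m, 'n) chart \<Rightarrow> 'm \<Rightarrow> real ^ 'n" where
  "chart_fun c = snd c"

definition chart_img :: "('m, 'n) chart \<Rightarrow> (real ^ 'n) set" where
  "chart_img c = chart_fun c ` chart_dom c"

definition chart_inv :: "('m, 'n) chart \<Rightarrow> real ^ 'n \<Rightarrow> 'm" where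
  "chart_inv c = inv_into (chart_dom c) (chart_fun c)"

definition topological_chart :: "('m::topological_space, 'n::finite) chart \<Rightarrow> bool" where
  "topological_chart c \<longleftrightarrow>
     open (chart_dom c) \<and> open (chart_img c) \<and>
     homeomorphism (chart_dom c) (chart_img c) (chart_fun c) (chart_inv c)"

(* The map s read in the chart c at the source and the chart d at the target. *)
definition coord_rep :: "('m, 'n) chart \<Rightarrow> ('m, 'n) chart \<Rightarrow> ('m \<Rightarrow> 'm) \<Rightarrow> real ^ 'n \<Rightarrow> real ^ 'n" where
  "coord_rep c d s = chart_fun d \<circ> s \<circ> chart_inv c"

definition coord_rep_dom :: "('m, 'n) chart \<Rightarrow> ('m, 'n) chart \<Rightarrow> ('m \<Rightarrow> 'm) \<Rightarrow> (real ^ 'n) set" where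
  "coord_rep_dom c d s = chart_fun c ` (chart_dom c \<inter> s -` chart_dom d)"

definition compatible :: "('m, 'n::finite) chart \<Rightarrow> ('m, 'n) chart \<Rightarrow> bool" where
  "compatible c d \<longleftrightarrow>
     smooth_on (coord_rep_dom c d id) (coord_rep c d id) \<and>
     smooth_on (coord_rep_dom d c id) (coord_rep d c id)"

(* A smooth structure on the whole type 'm, given by its maximal atlas; the Hausdorff and
   second countability axioms are expressed by the sort of 'm. *)
definition smooth_manifold ::
  "('m::{t2_space, second_countable_topology}, 'n::finite) chart set \<Rightarrow> bool" where
  "smooth_manifold A \<longleftrightarrow>
     (\<forall>c\<in>A. topological_chart c) \<and>
     (\<Union>c\<in>A. chart_dom c) = UNIV \<and>
     (\<forall>c\<in>A. \<forall>d\<in>A. compatible c d) \<and>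
     (\<forall>c. topological_chart c \<and> (\<forall>d\<in>A. compatible c d) \<longrightarrow> c \<in> A)"

definition smooth_map :: "('m::topological_space, 'n::finite) chart set \<Rightarrow> ('m \<Rightarrow> 'm) \<Rightarrow> bool" where
  "smooth_map A s \<longleftrightarrow>
     continuous_on UNIV s \<and>
     (\<forall>c\<in>A. \<forall>d\<in>A. smooth_on (coord_rep_dom c d s) (coord_rep c d s))"

definition diffeomorphism :: "('m::topological_space, 'n::finite) chart set \<Rightarrow> ('m \<Rightarrow> 'm) \<Rightarrow> bool" where
  "diffeomorphism A s \<longleftrightarrow> bij s \<and> smooth_map A s \<and> smooth_map A (inv_into UNIV s)"


subsection \<open>Riemannian metrics, isometries and the Riemannian volume\<close>

(* A Riemannian metric in components: g c p v w is the inner product, at the point p, of the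
   tangent vectors whose coordinates in the chart c are v and w.  The last two clauses say that
   the components are smooth and transform as a covariant 2-tensor under changes of chart. *)
definition riemannian_metric ::
  "('m::topological_space, 'n::finite) chart set
    \<Rightarrow> (('m, 'n) chart \<Rightarrow> 'm \<Rightarrow> real ^ 'n \<Rightarrow> real ^ 'n \<Rightarrow> real) \<Rightarrow> bool" where
  "riemannian_metric A g \<longleftrightarrow>
     (\<forall>c\<in>A. \<forall>p\<in>chart_dom c.
        bilinear (g c p) \<and>
        (\<forall>v w. g c p v w = g c p w v) \<and>
        (\<forall>v. v \<noteq> 0 \<longrightarrow> g c p v v > 0)) \<and>
     (\<forall>c\<in>A. \<forall>v w. smooth_on (chart_img c) (\<lambda>x. g c (chart_inv c x) v w)) \<and>
     (\<forall>c\<in>A. \<forall>d\<in>A. \<forall>p\<in>chart_dom c \<inter> chart_dom d. \<forall>v w.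
        g c p v w =
          g d p (frechet_derivative (coord_rep c d id) (at (chart_fun c p)) v)
                (frechet_derivative (coord_rep c d id) (at (chart_fun c p)) w))"

definition riemannian_isometry ::
  "('m::topological_space, 'n::finite) chart set
    \<Rightarrow> (('m, 'n) chart \<Rightarrow> 'm \<Rightarrow> real ^ 'n \<Rightarrow> real ^ 'n \<Rightarrow> real) \<Rightarrow> ('m \<Rightarrow> 'm) \<Rightarrow> bool" where
  "riemannian_isometry A g s \<longleftrightarrow>
     diffeomorphism A s \<and>
     (\<forall>c\<in>A. \<forall>d\<in>A. \<forall>p\<in>chart_dom c \<inter> s -` chart_dom d. \<forall>v w.
        g c p v w =
          g d (s p) (frechet_derivative (coord_rep c d s) (at (chart_fun c p)) v)
                    (frechet_derivative (coord_rep c d s) (at (chart_fun c p)) w))"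

definition isometry_group ::
  "('m::topological_space, 'n::finite) chart set
    \<Rightarrow> (('m, 'n) chart \<Rightarrow> 'm \<Rightarrow> real ^ 'n \<Rightarrow> real ^ 'n \<Rightarrow> real) \<Rightarrow> ('m \<Rightarrow> 'm) monoid" where
  "isometry_group A g = \<lparr>carrier = {s. riemannian_isometry A g s}, mult = (\<circ>), one = id\<rparr>"

(* The Borel measure that in every chart is sqrt (det (g_ij)) dx.  As countably many charts
   cover the manifold, this determines it uniquely. *)
definition riemannian_volume ::
  "('m::topological_space, 'n::finite) chart set
    \<Rightarrow> (('m, 'n) chart \<Rightarrow> 'm \<Rightarrow> real ^ 'n \<Rightarrow> real ^ 'n \<Rightarrow> real) \<Rightarrow> 'm measure \<Rightarrow> bool" where
  "riemannian_volume A g \<omega> \<longleftrightarrow>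
     sets \<omega> = sets borel \<and>
     (\<forall>c\<in>A. \<forall>B\<in>sets borel. B \<subseteq> chart_dom c \<longrightarrow>
        emeasure \<omega> B =
          (\<integral>\<^sup>+ x\<in>chart_fun c ` B.
             ennreal (sqrt (det (\<chi> i j. g c (chart_inv c x) (axis i 1) (axis j 1)))) \<partial>lborel))"


subsection \<open>Locally compact groups and Haar measure\<close>

definition compact_open_topology :: "('m::topological_space \<Rightarrow> 'm) set \<Rightarrow> ('m \<Rightarrow> 'm) topology" where
  "compact_open_topology H =
     topology_generated_by {{s \<in> H. s ` K \<subseteq> U} | K U. compact K \<and> open U}"

definition locally_compact_group :: "'g monoid \<Rightarrow> 'g topology \<Rightarrow> bool" where
  "locally_compact_group G T \<longleftrightarrow>
     group G \<and> topspace T = carrier G \<and>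
     continuous_map (prod_topology T T) T (\<lambda>(x, y). x \<otimes>\<^bsub>G\<^esub> y) \<and>
     continuous_map T T (\<lambda>x. inv\<^bsub>G\<^esub> x) \<and>
     Hausdorff_space T \<and> locally_compact_space T"

definition left_haar_measure :: "'g monoid \<Rightarrow> 'g topology \<Rightarrow> 'g measure \<Rightarrow> bool" where
  "left_haar_measure G T \<mu> \<longleftrightarrow>
     space \<mu> = carrier G \<and>
     sets \<mu> = sigma_sets (carrier G) {U. openin T U} \<and>
     emeasure \<mu> (carrier G) \<noteq> 0 \<and>
     (\<forall>K. compactin T K \<longrightarrow> emeasure \<mu> K < \<infinity>) \<and>
     (\<forall>B\<in>sets \<mu>. emeasure \<mu> B = (INF U\<in>{U. openin T U \<and> B \<subseteq> U}. emeasure \<mu> U)) \<and>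
     (\<forall>U. openin T U \<longrightarrow> emeasure \<mu> U = (SUP K\<in>{K. compactin T K \<and> K \<subseteq> U}. emeasure \<mu> K)) \<and>
     (\<forall>x\<in>carrier G. \<forall>B\<in>sets \<mu>. emeasure \<mu> ((\<lambda>y. x \<otimes>\<^bsub>G\<^esub> y) ` B) = emeasure \<mu> B)"


subsection \<open>Square-integrable functions, equivariance, second order correlation\<close>

(* Honest functions rather than classes modulo null sets, because values at single points of the
   group are used. *)
definition L2 :: "'x measure \<Rightarrow> ('x \<Rightarrow> real) set" where
  "L2 N = {f \<in> borel_measurable N. integrable N (\<lambda>x. (f x)\<^sup>2)}"

definition L2_norm :: "'x measure \<Rightarrow> ('x \<Rightarrow> real) \<Rightarrow> real" where
  "L2_norm N f = sqrt (\<integral>x. (f x)\<^sup>2 \<partial>N)"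

(* act is the action of the group G on the underlying space. *)
definition translate ::
  "'g monoid \<Rightarrow> ('g \<Rightarrow> 'x \<Rightarrow> 'x) \<Rightarrow> 'g \<Rightarrow> ('x \<Rightarrow> real) \<Rightarrow> 'x \<Rightarrow> real" where
  "translate G act a h = (\<lambda>x. h (act (inv\<^bsub>G\<^esub> a) x))"

definition translate2 ::
  "'g monoid \<Rightarrow> ('g \<Rightarrow> 'x \<Rightarrow> 'x) \<Rightarrow> 'g \<Rightarrow> ('x \<times> 'x \<Rightarrow> real) \<Rightarrow> 'x \<times> 'x \<Rightarrow> real" where
  "translate2 G act a w = (\<lambda>(x1, x2). w (act (inv\<^bsub>G\<^esub> a) x1, act (inv\<^bsub>G\<^esub> a) x2))"

definition correlation2 ::
  "'g monoid \<Rightarrow> ('g \<Rightarrow> 'x \<Rightarrow> 'x) \<Rightarrow> 'x measure \<Rightarrow> ('x \<Rightarrow> real) \<Rightarrow> ('x \<times> 'x \<Rightarrow> real) \<Rightarrow> 'g \<Rightarrow> real" where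
  "correlation2 G act N f w a =
     (\<integral>x2. (\<integral>x1. f x1 * f x2 * translate2 G act a w (x1, x2) \<partial>N) \<partial>N)"

definition equivariant ::
  "'g monoid \<Rightarrow> ('g \<Rightarrow> 'x \<Rightarrow> 'x) \<Rightarrow> 'x measure \<Rightarrow> (('x \<Rightarrow> real) \<Rightarrow> 'g \<Rightarrow> real) \<Rightarrow> bool" where
  "equivariant G act N F \<longleftrightarrow>
     (\<forall>a\<in>carrier G. \<forall>f\<in>L2 N. \<forall>x\<in>carrier G.
        F (translate G act a f) x = translate G (mult G) a (F f) x)"

definition L2_linear :: "'x measure \<Rightarrow> 'g measure \<Rightarrow> (('x \<Rightarrow> real) \<Rightarrow> 'g \<Rightarrow> real) \<Rightarrow> bool" where
  "L2_linear N \<mu> T \<longleftrightarrow>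
     T ` L2 N \<subseteq> L2 \<mu> \<and>
     (\<forall>f\<in>L2 N. \<forall>h\<in>L2 N. \<forall>a b. \<forall>x\<in>space \<mu>.
        T (\<lambda>y. a * f y + b * h y) x = a * T f x + b * T h x)"

(* Every evaluation f |-> T f x is a bounded functional for the L2 norm.  In particular the
   value T f x depends only on the class of f modulo null sets. *)
definition evaluations_bounded :: "'x measure \<Rightarrow> 'g measure \<Rightarrow> (('x \<Rightarrow> real) \<Rightarrow> 'g \<Rightarrow> real) \<Rightarrow> bool" where
  "evaluations_bounded N \<mu> T \<longleftrightarrow>
     (\<forall>x\<in>space \<mu>. \<exists>C. \<forall>f\<in>L2 N. \<bar>T f x\<bar> \<le> C * L2_norm N f)"

end

theory Submission
  imports Defs
begin

text \<open>
  Equivariance reduces everything to the identity element: \<open>F f a = F (a\<^sup>-\<^sup>1 \<cdot> f) 1\<close>. The functionals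
  \<open>h \<mapsto> F\<^sub>i\<^sub>,\<^sub>1 h 1\<close> and \<open>h \<mapsto> F\<^sub>i\<^sub>,\<^sub>2 h 1\<close> are bounded, so by Riesz they are integration
  against some \<open>u\<^sub>i\<close> and \<open>v\<^sub>i\<close> in \<open>L\<^sup>2\<close>, and \<open>w\<^sub>i (x, y) = u\<^sub>i x * v\<^sub>i y\<close> works because the measure is
  invariant under the group. For the Riemannian volume, invariance needs no change of variables: an
  isometry pulls a chart back to a chart that again lies in the maximal atlas and in which the metric has
  the same components.
\<close>

subsection \<open>Riesz representation on square-integrable functions\<close>

lemma L2_mult_integrable:
  assumes "f \<in> L2 N" "h \<in> L2 N"
  shows "integrable N (\<lambda>x. f x * h x)"
proof (rule Bochner_Integration.integrable_bound)
  show "integrable N (\<lambda>x. (f x)\<^sup>2 + (h x)\<^sup>2)" "(\<lambda>x. f x * h x) \<in> borel_measurable N"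
    using assms by (auto simp: L2_def)
  show "AE x in N. norm (f x * h x) \<le> norm ((f x)\<^sup>2 + (h x)\<^sup>2)"
  proof (rule AE_I2)
    fix x
    have "2 * \<bar>f x\<bar> * \<bar>h x\<bar> \<le> (f x)\<^sup>2 + (h x)\<^sup>2"
      using sum_squares_bound[of "\<bar>f x\<bar>" "\<bar>h x\<bar>"] by simp
    moreover have "0 \<le> \<bar>f x\<bar> * \<bar>h x\<bar>" by simp
    ultimately show "norm (f x * h x) \<le> norm ((f x)\<^sup>2 + (h x)\<^sup>2)"
      unfolding real_norm_def abs_mult by linarith
  qed
qed

text \<open>Arbitrary coefficients make differences, midpoints and the perturbations
  \<open>f + t * h\<close> instances of one expansion. The cross term carries the inner product that
  the variational argument extracts.\<close>

lemma L2_lincomb: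
  assumes "f \<in> L2 N" "h \<in> L2 N"
  shows "(\<lambda>x. a * f x + b * h x) \<in> L2 N"
    and "(\<integral>x. (a * f x + b * h x)\<^sup>2 \<partial>N) =
      a\<^sup>2 * (\<integral>x. (f x)\<^sup>2 \<partial>N) + 2 * a * b * (\<integral>x. f x * h x \<partial>N) + b\<^sup>2 * (\<integral>x. (h x)\<^sup>2 \<partial>N)"
proof -
  have eq: "(a * f x + b * h x)\<^sup>2 = a\<^sup>2 * (f x)\<^sup>2 + 2 * a * b * (f x * h x) + b\<^sup>2 * (h x)\<^sup>2" for x
    by (simp add: power2_eq_square algebra_simps)
  have [simp]: "integrable N (\<lambda>x. f x * h x)" by (rule L2_mult_integrable[OF assms])
  have [simp]: "integrable N (\<lambda>x. (f x)\<^sup>2)" "integrable N (\<lambda>x. (h x)\<^sup>2)"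
    using assms by (auto simp: L2_def)
  show "(\<lambda>x. a * f x + b * h x) \<in> L2 N"
    using assms by (auto simp: L2_def eq)
  show "(\<integral>x. (a * f x + b * h x)\<^sup>2 \<partial>N) =
      a\<^sup>2 * (\<integral>x. (f x)\<^sup>2 \<partial>N) + 2 * a * b * (\<integral>x. f x * h x \<partial>N) + b\<^sup>2 * (\<integral>x. (h x)\<^sup>2 \<partial>N)"
    unfolding eq by simp
qed

text \<open>A step of size \<open>d\<close> is either at most \<open>(1/2) ^ n\<close>, or satisfies
  \<open>1 \<le> 2 ^ n * d\<close> and hence \<open>d \<le> 2 ^ n * d\<^sup>2\<close>. So the steps
  are dominated by the given series plus a geometric one, and the sequence converges by
  telescoping.\<close>

lemma convergent_if_geometric_steps:
  fixes s :: "nat \<Rightarrow> real"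
  assumes "summable (\<lambda>n. 2 ^ n * (s (Suc n) - s n)\<^sup>2)"
  shows "convergent s"
proof -
  have "summable (\<lambda>n. s (Suc n) - s n)"
  proof (rule summable_comparison_test')
    show "summable (\<lambda>n. 2 ^ n * (s (Suc n) - s n)\<^sup>2 + (1/2) ^ n)"
      using assms by (intro summable_add summable_geometric) auto
    fix n :: nat
    define d where "d = \<bar>s (Suc n) - s n\<bar>"
    have "d \<le> 2 ^ n * d\<^sup>2 + (1/2) ^ n"
    proof (cases "d \<le> (1/2) ^ n")
      case True
      then show ?thesis by (simp add: add_increasing)
    next
      case False
      then have "1 \<le> 2 ^ n * d" by (simp add: field_simps power_divide)
      then have "d * 1 \<le> d * (2 ^ n * d)" by (intro mult_left_mono) (auto simp: d_def)
      then have "d \<le> 2 ^ n * d\<^sup>2" by (simp add: power2_eq_square mult_ac)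
      then show ?thesis by (simp add: add_increasing2)
    qed
    then show "norm (s (Suc n) - s n) \<le> 2 ^ n * (s (Suc n) - s n)\<^sup>2 + (1/2) ^ n"
      by (simp add: d_def)
  qed
  then have "convergent (\<lambda>n. \<Sum>i<n. s (Suc i) - s i)"
    by (simp add: summable_iff_convergent)
  then have "convergent (\<lambda>n. (\<Sum>i<n. s (Suc i) - s i) + s 0)"
    by (intro convergent_add convergent_const)
  then show ?thesis by (simp add: sum_lessThan_telescope)
qed

text \<open>
  The Cauchy condition is geometric so that the sequence itself converges almost everywhere, without
  passing to a subsequence.
\<close>

lemma L2_complete:
  assumes f: "\<And>n. f n \<in> L2 N"
    and cauchy: "\<And>n m. n \<le> m \<Longrightarrow> (\<integral>x. (f m x - f n x)\<^sup>2 \<partial>N) \<le> (1/4) ^ n"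
  shows "\<exists>u\<in>L2 N. \<forall>n. (\<integral>x. (f n x - u x)\<^sup>2 \<partial>N) \<le> (1/4) ^ n"
proof -
  have [measurable]: "f n \<in> borel_measurable N" for n using f by (auto simp: L2_def)
  have diff: "(\<lambda>x. h x - k x) \<in> L2 N" if "h \<in> L2 N" "k \<in> L2 N" for h k
    using L2_lincomb(1)[OF that, of 1 "-1"] by simp
  have nn: "(\<integral>\<^sup>+x. ennreal ((f m x - f n x)\<^sup>2) \<partial>N) \<le> ennreal ((1/4) ^ n)" if "n \<le> m" for n m
    using diff[OF f[of m] f[of n]] cauchy[OF that]
    by (subst nn_integral_eq_integral) (auto simp: L2_def intro!: ennreal_leI)
  \<comment> \<open>The weight \<open>2 ^ n\<close> still leaves
    \<open>2 ^ n * (1/4) ^ n = (1/2) ^ n\<close>, which is summable. The weighted sum of squared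
    steps thus has finite integral and is finite almost everywhere.\<close>
  have "(\<integral>\<^sup>+x. (\<Sum>n. ennreal (2 ^ n * (f (Suc n) x - f n x)\<^sup>2)) \<partial>N)
      = (\<Sum>n. \<integral>\<^sup>+x. ennreal (2 ^ n * (f (Suc n) x - f n x)\<^sup>2) \<partial>N)"
    by (intro nn_integral_suminf) auto
  also have "\<dots> \<le> (\<Sum>n. ennreal ((1/2) ^ n))"
  proof (intro suminf_le summableI)
    fix n :: nat
    have "(\<integral>\<^sup>+x. ennreal (2 ^ n * (f (Suc n) x - f n x)\<^sup>2) \<partial>N)
      = ennreal (2 ^ n) * (\<integral>\<^sup>+x. ennreal ((f (Suc n) x - f n x)\<^sup>2) \<partial>N)"
      by (subst nn_integral_cmult[symmetric]) (auto simp: ennreal_mult)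
    also have "\<dots> \<le> ennreal (2 ^ n) * ennreal ((1/4) ^ n)"
      by (intro mult_left_mono nn) auto
    also have "\<dots> = ennreal ((1/2) ^ n)"
      by (subst ennreal_mult[symmetric]) (auto simp flip: power_mult_distrib)
    finally show "(\<integral>\<^sup>+x. ennreal (2 ^ n * (f (Suc n) x - f n x)\<^sup>2) \<partial>N) \<le> ennreal ((1/2) ^ n)" .
  qed
  also have "\<dots> = ennreal (\<Sum>n. (1/2) ^ n)"
    by (intro suminf_ennreal2) (auto intro: summable_geometric)
  finally have "(\<integral>\<^sup>+x. (\<Sum>n. ennreal (2 ^ n * (f (Suc n) x - f n x)\<^sup>2)) \<partial>N) \<noteq> \<infinity>"
    by (auto simp: top_unique)
  then have "AE x in N. (\<Sum>n. ennreal (2 ^ n * (f (Suc n) x - f n x)\<^sup>2)) \<noteq> \<infinity>"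
    by (intro nn_integral_PInf_AE) auto
  then have conv: "AE x in N. convergent (\<lambda>n. f n x)"
  proof eventually_elim
    case (elim x)
    then show ?case
      by (intro convergent_if_geometric_steps summable_suminf_not_top) auto
  qed
  \<comment> \<open>Where the sequence diverges, \<open>lim\<close> is one unspecified constant;
    this concerns only a null set.\<close>
  define u where "u x = lim (\<lambda>n. f n x)" for x
  have [measurable]: "u \<in> borel_measurable N" unfolding u_def by measurable
  \<comment> \<open>Fatou's lemma carries the Cauchy estimate over to the limit in \<open>m\<close>,
    with \<open>n\<close> fixed.\<close>
  have bound: "(\<integral>\<^sup>+x. ennreal ((f n x - u x)\<^sup>2) \<partial>N) \<le> ennreal ((1/4) ^ n)" for n
  proof -
    have "(\<integral>\<^sup>+x. ennreal ((f n x - u x)\<^sup>2) \<partial>N)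
      = (\<integral>\<^sup>+x. liminf (\<lambda>m. ennreal ((f m x - f n x)\<^sup>2)) \<partial>N)"
    proof (rule nn_integral_cong_AE, use conv in eventually_elim)
      case (elim x)
      then have "(\<lambda>m. f m x) \<longlonglongrightarrow> u x" by (simp add: u_def convergent_LIMSEQ_iff)
      then have "(\<lambda>m. ennreal ((f m x - f n x)\<^sup>2)) \<longlonglongrightarrow> ennreal ((u x - f n x)\<^sup>2)"
        by (intro tendsto_ennrealI tendsto_intros)
      from lim_imp_Liminf[OF _ this] show ?case by (simp add: power2_commute)
    qed
    also have "\<dots> \<le> liminf (\<lambda>m. \<integral>\<^sup>+x. ennreal ((f m x - f n x)\<^sup>2) \<partial>N)"
      by (intro nn_integral_liminf) auto
    also have "\<dots> \<le> liminf (\<lambda>m. ennreal ((1/4) ^ n))"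
      by (intro Liminf_mono eventually_sequentiallyI[of n] nn)
    finally show ?thesis by (simp add: Liminf_const)
  qed
  have du: "(\<lambda>x. f n x - u x) \<in> L2 N" for n
    using bound[of n] unfolding L2_def
    by (auto intro!: integrableI_nonneg simp: le_less_trans)
  \<comment> \<open>\<open>u\<close> is the difference of \<open>f 0\<close> and
    \<open>f 0 - u\<close>, both square-integrable.\<close>
  have "u \<in> L2 N" using diff[OF f[of 0] du[of 0]] by simp
  moreover have "(\<integral>x. (f n x - u x)\<^sup>2 \<partial>N) \<le> (1/4) ^ n" for n
    using bound[of n] du[of n] by (subst (asm) nn_integral_eq_integral) (auto simp: L2_def)
  ultimately show ?thesis by blast
qed

text \<open>
  The representing function minimises \<open>\<parallel>f\<parallel>\<^sup>2 / 2 - \<phi> f\<close>; by the parallelogram law every sufficiently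
  fast minimising sequence is Cauchy.
\<close>

lemma L2_Riesz:
  fixes \<phi> :: "('x \<Rightarrow> real) \<Rightarrow> real"
  assumes lin: "\<And>f h a b. f \<in> L2 N \<Longrightarrow> h \<in> L2 N \<Longrightarrow> \<phi> (\<lambda>y. a * f y + b * h y) = a * \<phi> f + b * \<phi> h"
    and bdd: "\<And>f. f \<in> L2 N \<Longrightarrow> \<bar>\<phi> f\<bar> \<le> C * L2_norm N f"
  shows "\<exists>u\<in>L2 N. \<forall>h\<in>L2 N. \<phi> h = (\<integral>x. h x * u x \<partial>N)"
proof -
  define q where "q f = (\<integral>x. (f x)\<^sup>2 \<partial>N)" for f :: "'x \<Rightarrow> real"
  define J where "J f = q f / 2 - \<phi> f" for f
  have q_nonneg: "0 \<le> q f" for f unfolding q_def by simp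
  have q_lincomb: "q (\<lambda>x. a * f x + b * h x) = a\<^sup>2 * q f + 2 * a * b * (\<integral>x. f x * h x \<partial>N) + b\<^sup>2 * q h"
    if "f \<in> L2 N" "h \<in> L2 N" for f h a b
    unfolding q_def by (rule L2_lincomb(2)[OF that])
  \<comment> \<open>With \<open>s\<close> the norm of \<open>f\<close>, the bound on
    \<open>\<phi>\<close> and \<open>C * s \<le> C\<^sup>2 / 2 + s\<^sup>2 / 2\<close> keep the
    functional bounded below, so that its infimum is meaningful.\<close>
  have J_below: "- C\<^sup>2 / 2 \<le> J f" if "f \<in> L2 N" for f
  proof -
    have "0 \<le> (C - sqrt (q f))\<^sup>2" by simp
    then have "C * sqrt (q f) \<le> C\<^sup>2 / 2 + q f / 2"
      using q_nonneg[of f] by (simp add: power2_diff)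
    then show ?thesis using bdd[OF that] by (auto simp: J_def L2_norm_def q_def abs_le_iff)
  qed
  define d where "d = Inf (J ` L2 N)"
  have bb: "bdd_below (J ` L2 N)" using J_below by (auto intro!: bdd_belowI)
  have zero: "(\<lambda>x. 0) \<in> L2 N" by (simp add: L2_def)
  have d_le: "d \<le> J f" if "f \<in> L2 N" for f
    unfolding d_def using bb that by (auto intro: cInf_lower)
  \<comment> \<open>The tolerance is an eighth because the parallelogram identity multiplies the sum
    of two tolerances by 4, which gives exactly the \<open>(1/4) ^ n\<close> that completeness asks
    for.\<close>
  have "\<exists>f\<in>L2 N. J f < d + (1/4) ^ n / 8" for n
    using cInf_lessD[of "J ` L2 N" "d + (1/4) ^ n / 8"] zero by (auto simp: d_def)
  then obtain f where f: "\<And>n. f n \<in> L2 N" and Jf: "\<And>n. J (f n) < d + (1/4) ^ n / 8" by metis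
  \<comment> \<open>The linear parts cancel, since twice the value of \<open>\<phi>\<close> at the
    midpoint is \<open>\<phi> h + \<phi> k\<close>.\<close>
  have parallelogram: "q (\<lambda>x. h x - k x) / 4 = J h + J k - 2 * J (\<lambda>x. 1/2 * h x + 1/2 * k x)"
    if "h \<in> L2 N" "k \<in> L2 N" for h k
    using q_lincomb[OF that, of 1 "-1"] q_lincomb[OF that, of "1/2" "1/2"] lin[OF that, of "1/2" "1/2"]
    by (simp add: J_def power2_eq_square field_simps)
  have "(\<integral>x. (f m x - f n x)\<^sup>2 \<partial>N) \<le> (1/4) ^ n" if "n \<le> m" for n m
  proof -
    have "q (\<lambda>x. f m x - f n x) / 4 \<le> J (f m) + J (f n) - 2 * d"
      using parallelogram[OF f f, of m n] d_le[OF L2_lincomb(1)[OF f[of m] f[of n], of "1/2" "1/2"]] by simp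
    moreover have "(1/4::real) ^ m \<le> (1/4) ^ n" using that by (intro power_decreasing) auto
    ultimately show ?thesis using Jf[of m] Jf[of n] unfolding q_def by linarith
  qed
  then obtain u where u: "u \<in> L2 N" and lim: "\<And>n. q (\<lambda>x. f n x - u x) \<le> (1/4) ^ n"
    using L2_complete[of f N] f unfolding q_def by blast
  have "\<phi> h = (\<integral>x. h x * u x \<partial>N)" if h: "h \<in> L2 N" for h
  proof -
    define D where "D = \<phi> h - (\<integral>x. u x * h x \<partial>N)"
    \<comment> \<open>First-order condition at the minimum, tested on the almost minimisers
      \<open>f n\<close> instead of on \<open>u\<close>, so that continuity of \<open>J\<close> is
      not involved. The error \<open>(1/4) ^ n\<close> vanishes afterwards as \<open>n\<close>
      grows.\<close>
    have step: "t * D \<le> t\<^sup>2 * q h + (1/4) ^ n" for t n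
    proof -
      have "d \<le> J (\<lambda>x. 1 * f n x + t * h x)"
        by (intro d_le L2_lincomb f h)
      also have "\<dots> = J (f n) + t * (\<integral>x. f n x * h x \<partial>N) + t\<^sup>2 * q h / 2 - t * \<phi> h"
        unfolding J_def q_lincomb[OF f h] lin[OF f h] by (simp add: field_simps)
      finally have 1: "t * \<phi> h - t * (\<integral>x. f n x * h x \<partial>N) \<le> (1/4) ^ n / 8 + t\<^sup>2 * q h / 2"
        using Jf[of n] by simp
      have v: "(\<lambda>x. f n x - u x) \<in> L2 N" using L2_lincomb(1)[OF f u, of 1 _ "-1"] by simp
      \<comment> \<open>Nonnegativity of this square does the work of Cauchy-Schwarz: it replaces
        the inner product of \<open>f n\<close> and \<open>h\<close> by that of \<open>u\<close> and
        \<open>h\<close>, at a cost again quadratic in \<open>t\<close>.\<close>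
      have "0 \<le> q (\<lambda>x. 1 * (f n x - u x) + (- t) * h x)" by (rule q_nonneg)
      also have "\<dots> = q (\<lambda>x. f n x - u x) - 2 * t * (\<integral>x. (f n x - u x) * h x \<partial>N) + t\<^sup>2 * q h"
        using q_lincomb[OF v h, of 1 "- t"] by simp
      also have "(\<integral>x. (f n x - u x) * h x \<partial>N) = (\<integral>x. f n x * h x \<partial>N) - (\<integral>x. u x * h x \<partial>N)"
        using L2_mult_integrable[OF f h] L2_mult_integrable[OF u h] by (simp add: left_diff_distrib)
      finally have 2: "t * (\<integral>x. f n x * h x \<partial>N) - t * (\<integral>x. u x * h x \<partial>N) \<le> (1/4) ^ n / 2 + t\<^sup>2 * q h / 2"
        using lim[of n] by (simp add: algebra_simps)
      have "0 \<le> (1/4::real) ^ n" by simp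
      with 1 2 show ?thesis unfolding D_def right_diff_distrib by linarith
    qed
    have "t * D \<le> t\<^sup>2 * q h" for t
    proof (rule tendsto_lowerbound[of "\<lambda>n. t\<^sup>2 * q h + (1/4) ^ n" _ sequentially])
      have "(\<lambda>n. t\<^sup>2 * q h + (1/4) ^ n) \<longlonglongrightarrow> t\<^sup>2 * q h + 0"
        by (intro tendsto_add tendsto_const LIMSEQ_realpow_zero) auto
      then show "(\<lambda>n. t\<^sup>2 * q h + (1/4) ^ n) \<longlonglongrightarrow> t\<^sup>2 * q h" by simp
    qed (auto simp: step)
    \<comment> \<open>A linear term bounded by a quadratic one for every \<open>t\<close> must
      vanish. The summand 1 keeps the chosen \<open>t\<close> well defined when
      \<open>q h = 0\<close>.\<close>
    from this[of "D / (q h + 1)"] have "D\<^sup>2 / (q h + 1) \<le> D\<^sup>2 * q h / (q h + 1)\<^sup>2"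
      by (simp add: power2_eq_square)
    then have "D\<^sup>2 * (q h + 1) \<le> D\<^sup>2 * q h"
      using q_nonneg[of h] by (simp add: divide_simps power2_eq_square split: if_splits)
    then have "D = 0" by (simp add: distrib_left)
    then show ?thesis by (simp add: D_def mult.commute)
  qed
  then show ?thesis using u by blast
qed

subsection \<open>Kernels on the product space\<close>

text \<open>
  The factors need not be sigma-finite, and then iterated integration of indicators may fail to be a
  measure; in that case the product is the zero measure by definition. Hence only an inequality.
\<close>

lemma emeasure_pair_measure_Times_le:
  assumes A: "A \<in> sets M" and B: "B \<in> sets N"
  shows "emeasure (M \<Otimes>\<^sub>M N) (A \<times> B) \<le> emeasure M A * emeasure N B"
proof -
  have "emeasure (M \<Otimes>\<^sub>M N) (A \<times> B) \<le> (\<integral>\<^sup>+x. \<integral>\<^sup>+y. indicator (A \<times> B) (x, y) \<partial>N \<partial>M)"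
    unfolding pair_measure_def by (simp add: emeasure_measure_of_conv)
  also have "\<dots> = (\<integral>\<^sup>+x. emeasure N B * indicator A x \<partial>M)"
    using B by (intro nn_integral_cong) (auto simp: indicator_times nn_integral_cmult mult.commute)
  also have "\<dots> = emeasure M A * emeasure N B"
    using A by (subst nn_integral_cmult_indicator) (auto simp: mult.commute)
  finally show ?thesis .
qed

text \<open>The inequality for rectangles extends to products of functions by induction on the first
  factor and, for an indicator there, on the second. An upper bound suffices, as it only serves to
  show square-integrability of product kernels.\<close>

lemma nn_integral_pair_measure_mult_le:
  fixes f :: "'a \<Rightarrow> ennreal" and h :: "'b \<Rightarrow> ennreal"
  assumes f: "f \<in> borel_measurable M" and h: "h \<in> borel_measurable N"
  shows "(\<integral>\<^sup>+z. f (fst z) * h (snd z) \<partial>(M \<Otimes>\<^sub>M N)) \<le> (\<integral>\<^sup>+x. f x \<partial>M) * (\<integral>\<^sup>+y. h y \<partial>N)"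
  using f
proof (induction rule: borel_measurable_induct)
  case (cong f f')
  then have "(\<integral>\<^sup>+z. f (fst z) * h (snd z) \<partial>(M \<Otimes>\<^sub>M N)) = (\<integral>\<^sup>+z. f' (fst z) * h (snd z) \<partial>(M \<Otimes>\<^sub>M N))"
    by (intro nn_integral_cong) (auto simp: space_pair_measure)
  with cong show ?case by (simp cong: nn_integral_cong)
next
  case (set A)
  note [measurable] = set
  \<comment> \<open>The first factor is now an indicator; the inner induction builds up the second
    one.\<close>
  from h show ?case
  proof (induction rule: borel_measurable_induct)
    case (cong h h')
    then have "(\<integral>\<^sup>+z. indicator A (fst z) * h (snd z) \<partial>(M \<Otimes>\<^sub>M N)) = (\<integral>\<^sup>+z. indicator A (fst z) * h' (snd z) \<partial>(M \<Otimes>\<^sub>M N))"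
      by (intro nn_integral_cong) (auto simp: space_pair_measure)
    with cong show ?case by (simp cong: nn_integral_cong)
  next
    case (set B)
    have "(\<integral>\<^sup>+z. indicator A (fst z) * indicator B (snd z) \<partial>(M \<Otimes>\<^sub>M N))
      = (\<integral>\<^sup>+z. indicator (A \<times> B) z \<partial>(M \<Otimes>\<^sub>M N))"
      by (intro nn_integral_cong) (auto simp: indicator_def)
    then show ?case
      using \<open>A \<in> sets M\<close> set emeasure_pair_measure_Times_le[of A M B N] by simp
  next
    case (mult h c)
    note [measurable] = \<open>h \<in> _\<close>
    show ?case using mult_left_mono[OF mult.IH, of c]
      by (simp add: nn_integral_cmult mult.left_commute[of _ c])
  next
    case (add h k)
    note [measurable] = \<open>h \<in> _\<close> \<open>k \<in> _\<close>
    show ?case using add_mono[OF add.IH(2) add.IH(1)]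
      by (simp add: nn_integral_add distrib_left)
  next
    case (seq U)
    note [measurable] = \<open>\<And>i. U i \<in> _\<close>
    \<comment> \<open>Monotone convergence handles the left side; on the right every
      \<open>U i\<close> lies below the supremum.\<close>
    have "(\<integral>\<^sup>+z. indicator A (fst z) * (SUP i. U i) (snd z) \<partial>(M \<Otimes>\<^sub>M N))
      = (\<integral>\<^sup>+z. (SUP i. indicator A (fst z) * U i (snd z)) \<partial>(M \<Otimes>\<^sub>M N))"
      by (simp add: SUP_mult_left_ennreal image_comp)
    also have "\<dots> = (SUP i. \<integral>\<^sup>+z. indicator A (fst z) * U i (snd z) \<partial>(M \<Otimes>\<^sub>M N))"
      using \<open>incseq U\<close>
      by (intro nn_integral_monotone_convergence_SUP) (auto simp: incseq_def le_fun_def intro!: mult_left_mono)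
    also have "\<dots> \<le> (\<integral>\<^sup>+x. indicator A x \<partial>M) * (\<integral>\<^sup>+y. (SUP i. U i) y \<partial>N)"
      by (intro SUP_least order_trans[OF seq.IH] mult_left_mono nn_integral_mono) (auto intro: SUP_upper)
    finally show ?case .
  qed
next
  case (mult f c)
  note [measurable] = \<open>f \<in> _\<close> h
  show ?case using mult_left_mono[OF mult.IH, of c]
    by (simp add: nn_integral_cmult mult.assoc)
next
  case (add f k)
  note [measurable] = \<open>f \<in> _\<close> \<open>k \<in> _\<close> h
  show ?case using add_mono[OF add.IH(2) add.IH(1)]
    by (simp add: nn_integral_add distrib_right)
next
  case (seq U)
  note [measurable] = \<open>\<And>i. U i \<in> _\<close> h
  have "(\<integral>\<^sup>+z. (SUP i. U i) (fst z) * h (snd z) \<partial>(M \<Otimes>\<^sub>M N))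
    = (\<integral>\<^sup>+z. (SUP i. U i (fst z) * h (snd z)) \<partial>(M \<Otimes>\<^sub>M N))"
    by (simp add: SUP_mult_right_ennreal image_comp)
  also have "\<dots> = (SUP i. \<integral>\<^sup>+z. U i (fst z) * h (snd z) \<partial>(M \<Otimes>\<^sub>M N))"
    using \<open>incseq U\<close>
    by (intro nn_integral_monotone_convergence_SUP) (auto simp: incseq_def le_fun_def intro!: mult_right_mono)
  also have "\<dots> \<le> (\<integral>\<^sup>+x. (SUP i. U i) x \<partial>M) * (\<integral>\<^sup>+y. h y \<partial>N)"
    by (intro SUP_least order_trans[OF seq.IH] mult_right_mono nn_integral_mono) (auto intro: SUP_upper)
  finally show ?case .
qed

text \<open>The square of the kernel is again a product of one-variable functions, so its integral
  is at most the product of the two finite integrals of squares.\<close>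

lemma L2_tensor:
  assumes u: "u \<in> L2 M" and v: "v \<in> L2 N"
  shows "(\<lambda>z. u (fst z) * v (snd z)) \<in> L2 (M \<Otimes>\<^sub>M N)"
proof -
  have [measurable]: "u \<in> borel_measurable M" "v \<in> borel_measurable N"
    using u v by (auto simp: L2_def)
  have "(\<integral>\<^sup>+z. ennreal ((u (fst z) * v (snd z))\<^sup>2) \<partial>(M \<Otimes>\<^sub>M N))
    = (\<integral>\<^sup>+z. ennreal ((u (fst z))\<^sup>2) * ennreal ((v (snd z))\<^sup>2) \<partial>(M \<Otimes>\<^sub>M N))"
    by (simp add: power_mult_distrib ennreal_mult)
  also have "\<dots> \<le> (\<integral>\<^sup>+x. ennreal ((u x)\<^sup>2) \<partial>M) * (\<integral>\<^sup>+y. ennreal ((v y)\<^sup>2) \<partial>N)"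
    by (rule nn_integral_pair_measure_mult_le) auto
  also have "\<dots> < \<infinity>"
    using u v by (auto simp: L2_def nn_integral_eq_integral ennreal_mult_less_top)
  finally show ?thesis
    by (auto simp: L2_def intro!: integrableI_nonneg)
qed

section \<open>Measure-preserving actions and second order kernels\<close>

lemma distr_eq_if_emeasure_image:
  assumes a: "a \<in> measurable N N" and b: "b \<in> measurable N N"
    and ba: "\<And>x. x \<in> space N \<Longrightarrow> b (a x) = x" and ab: "\<And>x. x \<in> space N \<Longrightarrow> a (b x) = x"
    and image: "\<And>B. B \<in> sets N \<Longrightarrow> emeasure N (b ` B) = emeasure N B"
  shows "distr N N a = N"
proof (rule measure_eqI)
  fix B assume "B \<in> sets (distr N N a)"
  then have B: "B \<in> sets N" by simp
  \<comment> \<open>Invariance is known for images of sets while \<open>distr\<close> uses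
    preimages; for mutually inverse maps the two agree.\<close>
  have "b ` B = a -` B \<inter> space N"
  proof (intro equalityI subsetI)
    fix x assume "x \<in> a -` B \<inter> space N"
    then show "x \<in> b ` B" using ba[of x] by (metis IntD1 IntD2 image_eqI vimageD)
  next
    fix x assume "x \<in> b ` B"
    then show "x \<in> a -` B \<inter> space N"
      using ab sets.sets_into_space[OF B] measurable_space[OF b] by auto
  qed
  then show "emeasure (distr N N a) B = emeasure N B"
    using image[OF B] by (simp add: emeasure_distr[OF a B])
qed simp

lemma L2_comp_measure_preserving:
  assumes s [measurable]: "s \<in> measurable N N" and "distr N N s = N" and f: "f \<in> L2 N"
  shows "(\<lambda>x. f (s x)) \<in> L2 N"
proof -
  have [measurable]: "f \<in> borel_measurable N" using f by (simp add: L2_def)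
  have "integrable (distr N N s) (\<lambda>x. (f x)\<^sup>2)"
    using assms by (simp add: L2_def)
  then show ?thesis
    by (subst (asm) integrable_distr_eq) (auto simp: L2_def)
qed

text \<open>The kernel is the product of the Riesz representers of the two evaluations at the
  identity, and invariance of the measure moves the group element from the kernel to
  \<open>f\<close>. The right-hand side stays at the identity because equivariance is assumed of the
  sum \<open>F\<close>, not of its single factors.\<close>

lemma second_order_kernel:
  fixes G :: "'g monoid" and act :: "'g \<Rightarrow> 'x \<Rightarrow> 'x"
  assumes G: "group G"
    and act: "\<And>a. a \<in> carrier G \<Longrightarrow> act a \<in> measurable N N"
    and act_inv: "\<And>a x. a \<in> carrier G \<Longrightarrow> x \<in> space N \<Longrightarrow> act (inv\<^bsub>G\<^esub> a) (act a x) = x"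
    and invariant: "\<And>a. a \<in> carrier G \<Longrightarrow> distr N N (act a) = N"
    and \<mu>: "space \<mu> = carrier G"
    and lin: "L2_linear N \<mu> S" "L2_linear N \<mu> R"
    and bdd: "evaluations_bounded N \<mu> S" "evaluations_bounded N \<mu> R"
  shows "\<exists>w\<in>L2 (N \<Otimes>\<^sub>M N). \<forall>f\<in>L2 N. \<forall>a\<in>carrier G.
    correlation2 G act N f w a =
      S (translate G act (inv\<^bsub>G\<^esub> a) f) \<one>\<^bsub>G\<^esub> * R (translate G act (inv\<^bsub>G\<^esub> a) f) \<one>\<^bsub>G\<^esub>"
proof -
  interpret group G by (rule G)
  have Riesz: "\<exists>u\<in>L2 N. \<forall>h\<in>L2 N. T h \<one>\<^bsub>G\<^esub> = (\<integral>x. h x * u x \<partial>N)"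
    if T: "L2_linear N \<mu> T" "evaluations_bounded N \<mu> T" for T
  proof -
    obtain C where "\<forall>f\<in>L2 N. \<bar>T f \<one>\<^bsub>G\<^esub>\<bar> \<le> C * L2_norm N f"
      using T(2) \<mu> unfolding evaluations_bounded_def by (metis one_closed)
    then show ?thesis
      using T(1) \<mu> by (intro L2_Riesz[of N "\<lambda>f. T f \<one>\<^bsub>G\<^esub>" C]) (auto simp: L2_linear_def)
  qed
  obtain u where u: "u \<in> L2 N" "\<And>h. h \<in> L2 N \<Longrightarrow> S h \<one>\<^bsub>G\<^esub> = (\<integral>x. h x * u x \<partial>N)"
    using Riesz[OF lin(1) bdd(1)] by blast
  obtain v where v: "v \<in> L2 N" "\<And>h. h \<in> L2 N \<Longrightarrow> R h \<one>\<^bsub>G\<^esub> = (\<integral>x. h x * v x \<partial>N)"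
    using Riesz[OF lin(2) bdd(2)] by blast
  have "correlation2 G act N f (\<lambda>z. u (fst z) * v (snd z)) a =
      S (translate G act (inv\<^bsub>G\<^esub> a) f) \<one>\<^bsub>G\<^esub> * R (translate G act (inv\<^bsub>G\<^esub> a) f) \<one>\<^bsub>G\<^esub>"
    if f: "f \<in> L2 N" and a: "a \<in> carrier G" for f a
  proof -
    note [measurable] = act[OF a] act[OF inv_closed[OF a]]
    have [measurable]: "f \<in> borel_measurable N" using f by (simp add: L2_def)
    have tr: "translate G act (inv\<^bsub>G\<^esub> a) f = (\<lambda>x. f (act a x))"
      using a by (simp add: translate_def)
    have fa: "(\<lambda>x. f (act a x)) \<in> L2 N"
      by (rule L2_comp_measure_preserving[OF act[OF a] invariant[OF a] f])
    \<comment> \<open>Substitution of \<open>act a x\<close> for \<open>x\<close>, under which the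
      measure is invariant.\<close>
    have shift: "(\<integral>x. f x * k (act (inv\<^bsub>G\<^esub> a) x) \<partial>N) = (\<integral>x. f (act a x) * k x \<partial>N)"
      if "k \<in> L2 N" for k
    proof -
      have [measurable]: "k \<in> borel_measurable N" using that by (simp add: L2_def)
      have "(\<integral>x. f x * k (act (inv\<^bsub>G\<^esub> a) x) \<partial>N)
        = (\<integral>x. f x * k (act (inv\<^bsub>G\<^esub> a) x) \<partial>distr N N (act a))"
        by (simp add: invariant[OF a])
      also have "\<dots> = (\<integral>x. f (act a x) * k (act (inv\<^bsub>G\<^esub> a) (act a x)) \<partial>N)"
        by (rule integral_distr) auto
      also have "\<dots> = (\<integral>x. f (act a x) * k x \<partial>N)"
        by (intro Bochner_Integration.integral_cong) (auto simp: act_inv a)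
      finally show ?thesis .
    qed
    \<comment> \<open>The integrand separates into a function of \<open>x\<close> times a function
      of \<open>y\<close>, so each integral takes the other factor out as a constant and Fubini's
      theorem is not involved.\<close>
    have "correlation2 G act N f (\<lambda>z. u (fst z) * v (snd z)) a
      = (\<integral>y. (\<integral>x. (f y * v (act (inv\<^bsub>G\<^esub> a) y)) * (f x * u (act (inv\<^bsub>G\<^esub> a) x)) \<partial>N) \<partial>N)"
      by (simp add: correlation2_def translate2_def mult_ac)
    also have "\<dots> = (\<integral>x. f x * u (act (inv\<^bsub>G\<^esub> a) x) \<partial>N) * (\<integral>y. f y * v (act (inv\<^bsub>G\<^esub> a) y) \<partial>N)"
      by simp
    finally show ?thesis
      unfolding tr u(2)[OF fa] v(2)[OF fa] shift[OF u(1)] shift[OF v(1)] .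
  qed
  with L2_tensor[OF u(1) v(1)] show ?thesis by blast
qed

text \<open>An abstract measure-preserving action covers both the manifold acted on by isometries
  and the group acted on by left multiplication.\<close>

lemma second_order_kernels:
  fixes G :: "'g monoid" and act :: "'g \<Rightarrow> 'x \<Rightarrow> 'x"
  assumes G: "group G"
    and act: "\<And>a. a \<in> carrier G \<Longrightarrow> act a \<in> measurable N N"
    and act_inv: "\<And>a x. a \<in> carrier G \<Longrightarrow> x \<in> space N \<Longrightarrow> act (inv\<^bsub>G\<^esub> a) (act a x) = x"
    and invariant: "\<And>a. a \<in> carrier G \<Longrightarrow> distr N N (act a) = N"
    and \<mu>: "space \<mu> = carrier G"
    and equi: "equivariant G act N F"
    and lin: "\<And>i. i \<in> I \<Longrightarrow> L2_linear N \<mu> (F1 i) \<and> L2_linear N \<mu> (F2 i)"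
    and bdd: "\<And>i. i \<in> I \<Longrightarrow> evaluations_bounded N \<mu> (F1 i) \<and> evaluations_bounded N \<mu> (F2 i)"
    and F: "\<And>f x. f \<in> L2 N \<Longrightarrow> x \<in> carrier G \<Longrightarrow> ((\<lambda>i. F1 i f x * F2 i f x) has_sum F f x) I"
  shows "\<exists>w. (\<forall>i\<in>I. w i \<in> L2 (N \<Otimes>\<^sub>M N)) \<and>
    (\<forall>f\<in>L2 N. \<forall>x\<in>carrier G. ((\<lambda>i. correlation2 G act N f (w i) x) has_sum F f x) I)"
proof -
  interpret group G by (rule G)
  have "\<forall>i\<in>I. \<exists>w. w \<in> L2 (N \<Otimes>\<^sub>M N) \<and> (\<forall>f\<in>L2 N. \<forall>a\<in>carrier G.
    correlation2 G act N f w a =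
      F1 i (translate G act (inv\<^bsub>G\<^esub> a) f) \<one>\<^bsub>G\<^esub> * F2 i (translate G act (inv\<^bsub>G\<^esub> a) f) \<one>\<^bsub>G\<^esub>)"
    using second_order_kernel[of G act N \<mu>, OF G act act_inv invariant \<mu>] lin bdd by blast
  then obtain w where w: "\<And>i. i \<in> I \<Longrightarrow> w i \<in> L2 (N \<Otimes>\<^sub>M N)"
    and corr: "\<And>i f a. i \<in> I \<Longrightarrow> f \<in> L2 N \<Longrightarrow> a \<in> carrier G \<Longrightarrow> correlation2 G act N f (w i) a =
      F1 i (translate G act (inv\<^bsub>G\<^esub> a) f) \<one>\<^bsub>G\<^esub> * F2 i (translate G act (inv\<^bsub>G\<^esub> a) f) \<one>\<^bsub>G\<^esub>"
    by metis
  have "((\<lambda>i. correlation2 G act N f (w i) a) has_sum F f a) I"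
    if f: "f \<in> L2 N" and a: "a \<in> carrier G" for f a
  proof -
    have "translate G act (inv\<^bsub>G\<^esub> a) f \<in> L2 N"
      using L2_comp_measure_preserving[OF act[OF a] invariant[OF a] f] a by (simp add: translate_def)
    \<comment> \<open>The expansion of \<open>F\<close> is used only at the identity, for the
      translated function; equivariance then identifies its sum with \<open>F f a\<close>.\<close>
    then have "((\<lambda>i. F1 i (translate G act (inv\<^bsub>G\<^esub> a) f) \<one>\<^bsub>G\<^esub> * F2 i (translate G act (inv\<^bsub>G\<^esub> a) f) \<one>\<^bsub>G\<^esub>)
      has_sum F (translate G act (inv\<^bsub>G\<^esub> a) f) \<one>\<^bsub>G\<^esub>) I"
      by (intro F) auto
    also have "F (translate G act (inv\<^bsub>G\<^esub> a) f) \<one>\<^bsub>G\<^esub> = translate G (mult G) (inv\<^bsub>G\<^esub> a) (F f) \<one>\<^bsub>G\<^esub>"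
      using equi f a by (auto simp: equivariant_def)
    also have "\<dots> = F f a"
      using a by (simp add: translate_def)
    finally show ?thesis
      using corr f a by (subst has_sum_cong) auto
  qed
  with w show ?thesis by blast
qed

subsection \<open>Invariance of the Riemannian volume\<close>

text \<open>On an open set equality of the functions forces equality of their derivatives, so the
  induction passes from \<open>f\<close> and \<open>h\<close> to their directional
  derivatives.\<close>

lemma Ck_on_cong:
  assumes "open S" "\<And>x. x \<in> S \<Longrightarrow> f x = h x" "Ck_on k S f"
  shows "Ck_on k S h"
  using assms(2,3)
proof (induction k arbitrary: f h)
  case 0
  then show ?case by (simp cong: continuous_on_cong)
next
  case (Suc k)
  have der: "(h has_derivative frechet_derivative f (at x)) (at x)" if "x \<in> S" for x
  proof (rule has_derivative_transform_within_open)
    show "(f has_derivative frechet_derivative f (at x)) (at x)"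
      using Suc.prems(2) that by (simp add: frechet_derivative_works)
  qed (use assms(1) that Suc.prems(1) in auto)
  have "Ck_on k S (\<lambda>x. frechet_derivative h (at x) v)" for v
  proof (rule Suc.IH)
    show "Ck_on k S (\<lambda>x. frechet_derivative f (at x) v)" using Suc.prems(2) by simp
  qed (simp add: frechet_derivative_at[OF der])
  then show ?case using der by (auto simp: differentiable_def)
qed

lemma smooth_on_cong:
  "open S \<Longrightarrow> (\<And>x. x \<in> S \<Longrightarrow> f x = h x) \<Longrightarrow> smooth_on S f \<Longrightarrow> smooth_on S h"
  unfolding smooth_on_def by (blast intro: Ck_on_cong)

section \<open>Charts pulled back along isometries\<close>

definition pullback_chart :: "('m \<Rightarrow> 'm) \<Rightarrow> ('m, 'n::finite) chart \<Rightarrow> ('m, 'n) chart" where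
  "pullback_chart s c = (s -` chart_dom c, chart_fun c \<circ> s)"

lemma chart_dom_pullback [simp]: "chart_dom (pullback_chart s c) = s -` chart_dom c"
  and chart_fun_pullback [simp]: "chart_fun (pullback_chart s c) = chart_fun c \<circ> s"
  by (simp_all add: pullback_chart_def chart_dom_def chart_fun_def)

lemma chart_img_pullback:
  assumes "surj s"
  shows "chart_img (pullback_chart s c) = chart_img c"
  unfolding chart_img_def chart_dom_pullback chart_fun_pullback image_comp[symmetric]
    surj_image_vimage_eq[OF assms] ..

text \<open>The restriction to the chart image matters: elsewhere \<open>inv_into\<close> gives
  unspecified points, on which the two sides need not agree.\<close>

lemma chart_inv_pullback:
  assumes s: "bij s" and c: "inj_on (chart_fun c) (chart_dom c)" and x: "x \<in> chart_img c"
  shows "chart_inv (pullback_chart s c) x = inv_into UNIV s (chart_inv c x)"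
proof -
  have [simp]: "s (inv_into UNIV s y) = y" for y
    using s by (simp add: bij_is_surj surj_f_inv_f)
  have *: "chart_inv c x \<in> chart_dom c" "chart_fun c (chart_inv c x) = x"
    using x by (auto simp: chart_img_def chart_inv_def intro: inv_into_into f_inv_into_f)
  have "inj_on (chart_fun c \<circ> s) (s -` chart_dom c)"
    using s c by (auto simp: inj_on_def bij_def)
  then show ?thesis
    using * unfolding chart_inv_def[of "pullback_chart s c"]
    by (intro inv_into_f_eq) auto
qed

lemma topological_chart_inj: "topological_chart c \<Longrightarrow> inj_on (chart_fun c) (chart_dom c)"
  by (auto simp: topological_chart_def homeomorphism_def intro: inj_on_inverseI)

lemma topological_chart_inv:
  assumes "topological_chart c"
  shows "x \<in> chart_img c \<Longrightarrow> chart_inv c x \<in> chart_dom c"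
    and "x \<in> chart_img c \<Longrightarrow> chart_fun c (chart_inv c x) = x"
  using assms by (auto simp: topological_chart_def homeomorphism_def)

lemma topological_chart_open_image:
  assumes c: "topological_chart c" and U: "open U" "U \<subseteq> chart_dom c"
  shows "open (chart_fun c ` U)"
proof -
  have "openin (top_of_set (chart_img c)) (chart_fun c ` U)"
    using c U unfolding topological_chart_def
    by (intro homeomorphism_imp_open_map[of "chart_dom c" _ _ "chart_inv c"]) (auto intro: open_subset)
  then show ?thesis
    using c openin_open_trans unfolding topological_chart_def by blast
qed

lemma topological_chart_pullback:
  assumes c: "topological_chart c" and s: "bij s" "continuous_on UNIV s" "continuous_on UNIV (inv_into UNIV s)"
  shows "topological_chart (pullback_chart s c)"
proof -
  let ?t = "inv_into UNIV s"
  have [simp]: "s (?t y) = y" "?t (s y) = y" for y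
    using s by (simp_all add: bij_is_surj surj_f_inv_f bij_is_inj)
  have "homeomorphism (s -` chart_dom c) (chart_dom c) s ?t"
    using s by (auto simp: homeomorphism_def intro: continuous_on_subset image_eqI[where x = "?t _"] image_eqI[where x = "s _"])
  then have "homeomorphism (s -` chart_dom c) (chart_img c) (chart_fun c \<circ> s) (?t \<circ> chart_inv c)"
    using c unfolding topological_chart_def by (blast intro: homeomorphism_compose)
  then have "homeomorphism (s -` chart_dom c) (chart_img c) (chart_fun c \<circ> s) (chart_inv (pullback_chart s c))"
    by (rule homeomorphism_cong) (auto simp: chart_inv_pullback s topological_chart_inj[OF c])
  moreover have "open (s -` chart_dom c)"
    using c s by (intro open_vimage) (auto simp: topological_chart_def)
  ultimately show ?thesis
    using c by (simp add: topological_chart_def chart_img_pullback bij_is_surj s)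
qed

text \<open>Changing from the pulled-back chart to \<open>d\<close> is the inverse of
  \<open>s\<close> read in \<open>c\<close> and \<open>d\<close>; changing back is \<open>s\<close>
  read in \<open>d\<close> and \<open>c\<close>. Both are smooth, and maximality of the atlas does
  the rest.\<close>

lemma pullback_chart_in_atlas:
  assumes A: "smooth_manifold A" and s: "diffeomorphism A s" and c: "c \<in> A"
  shows "pullback_chart s c \<in> A"
proof -
  let ?t = "inv_into UNIV s"
  have bij: "bij s" and cont: "continuous_on UNIV s" "continuous_on UNIV ?t"
    and smooth: "smooth_map A s" "smooth_map A ?t"
    using s by (auto simp: diffeomorphism_def smooth_map_def)
  have [simp]: "s (?t y) = y" "?t (s y) = y" for y
    using bij by (simp_all add: bij_is_surj surj_f_inv_f bij_is_inj)
  have top: "topological_chart d" if "d \<in> A" for d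
    using A that by (auto simp: smooth_manifold_def)
  have "compatible (pullback_chart s c) d" if d: "d \<in> A" for d
    unfolding compatible_def
  proof
    have dom: "coord_rep_dom (pullback_chart s c) d id = coord_rep_dom c d ?t"
      unfolding coord_rep_dom_def
      by (force intro: image_eqI[where x = "?t _"] image_eqI[where x = "s _"])
    \<comment> \<open>The two coordinate maps agree only on this domain, so smoothness transfers by
      congruence, which needs an open set.\<close>
    have "open (chart_dom c \<inter> ?t -` chart_dom d)"
      using top[OF c] top[OF d] cont by (auto intro!: open_Int open_vimage simp: topological_chart_def)
    then have "open (coord_rep_dom c d ?t)"
      unfolding coord_rep_dom_def by (intro topological_chart_open_image top c) auto
    moreover have "coord_rep c d ?t x = coord_rep (pullback_chart s c) d id x"
      if "x \<in> coord_rep_dom c d ?t" for x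
    proof -
      have "x \<in> chart_img c" using that by (auto simp: coord_rep_dom_def chart_img_def)
      then show ?thesis
        by (simp add: coord_rep_def chart_inv_pullback[OF bij topological_chart_inj[OF top[OF c]]])
    qed
    moreover have "smooth_on (coord_rep_dom c d ?t) (coord_rep c d ?t)"
      using smooth c d by (auto simp: smooth_map_def)
    ultimately show "smooth_on (coord_rep_dom (pullback_chart s c) d id) (coord_rep (pullback_chart s c) d id)"
      unfolding dom by (rule smooth_on_cong)
    have "coord_rep_dom d (pullback_chart s c) id = coord_rep_dom d c s"
      "coord_rep d (pullback_chart s c) id = coord_rep d c s"
      by (auto simp: coord_rep_dom_def coord_rep_def fun_eq_iff)
    then show "smooth_on (coord_rep_dom d (pullback_chart s c) id) (coord_rep d (pullback_chart s c) id)"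
      using smooth c d by (auto simp: smooth_map_def)
  qed
  then show ?thesis
    using A topological_chart_pullback[OF top[OF c] bij cont]
    unfolding smooth_manifold_def by blast
qed

text \<open>Read in the pulled-back chart at the source and in \<open>c\<close> at the target,
  \<open>s\<close> is the identity near the point. Its derivative is then the identity, and the
  isometry condition says that the components coincide.\<close>

lemma metric_pullback_chart:
  assumes A: "smooth_manifold A" and s: "riemannian_isometry A g s" and c: "c \<in> A"
    and p: "s p \<in> chart_dom c"
  shows "g (pullback_chart s c) p v w = g c (s p) v w"
proof -
  have s': "diffeomorphism A s" and bij: "bij s"
    using s by (auto simp: riemannian_isometry_def diffeomorphism_def)
  have top: "topological_chart c" using A c by (auto simp: smooth_manifold_def)
  let ?r = "coord_rep (pullback_chart s c) c s"
  have r: "?r x = x" if "x \<in> chart_img c" for x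
    using that bij
    by (simp add: coord_rep_def chart_inv_pullback[OF bij topological_chart_inj[OF top]]
        bij_is_surj surj_f_inv_f topological_chart_inv[OF top])
  have "(?r has_derivative (\<lambda>v. v)) (at (chart_fun c (s p)))"
  proof (rule has_derivative_transform_within_open[OF has_derivative_ident])
    show "open (chart_img c)" using top by (simp add: topological_chart_def)
    show "chart_fun c (s p) \<in> chart_img c" using p by (simp add: chart_img_def)
  qed (simp add: r)
  then have "frechet_derivative ?r (at (chart_fun c (s p))) = (\<lambda>v. v)"
    by (rule frechet_derivative_at[symmetric])
  moreover have "g (pullback_chart s c) p v w =
      g c (s p) (frechet_derivative ?r (at (chart_fun (pullback_chart s c) p)) v)
                (frechet_derivative ?r (at (chart_fun (pullback_chart s c) p)) w)"
    using s c p pullback_chart_in_atlas[OF A s' c] unfolding riemannian_isometry_def by auto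
  ultimately show ?thesis by simp
qed

lemma riemannian_volume_isometry_chart:
  assumes A: "smooth_manifold A" and vol: "riemannian_volume A g \<omega>"
    and s: "riemannian_isometry A g s" and c: "c \<in> A"
    and B: "B \<in> sets borel" "s ` B \<in> sets borel" "s ` B \<subseteq> chart_dom c"
  shows "emeasure \<omega> (s ` B) = emeasure \<omega> B"
proof -
  let ?c = "pullback_chart s c"
  have s': "diffeomorphism A s" and bij: "bij s"
    using s by (auto simp: riemannian_isometry_def diffeomorphism_def)
  have top: "topological_chart c" using A c by (auto simp: smooth_manifold_def)
  have sub: "B \<subseteq> chart_dom ?c" using B(3) by auto
  have "emeasure \<omega> B = (\<integral>\<^sup>+ x\<in>chart_fun ?c ` B.
      ennreal (sqrt (det (\<chi> i j. g ?c (chart_inv ?c x) (axis i 1) (axis j 1)))) \<partial>lborel)"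
    using vol B(1) sub pullback_chart_in_atlas[OF A s' c] unfolding riemannian_volume_def by blast
  also have "\<dots> = (\<integral>\<^sup>+ x\<in>chart_fun c ` s ` B.
      ennreal (sqrt (det (\<chi> i j. g c (chart_inv c x) (axis i 1) (axis j 1)))) \<partial>lborel)"
  proof (intro nn_integral_cong)
    fix x
    have "g ?c (chart_inv ?c x) v w = g c (chart_inv c x) v w" if "x \<in> chart_fun c ` s ` B" for v w
    proof -
      have x: "x \<in> chart_img c" using that B by (auto simp: chart_img_def)
      then have "s (chart_inv ?c x) = chart_inv c x"
        using bij by (simp add: chart_inv_pullback[OF bij topological_chart_inj[OF top]] bij_is_surj surj_f_inv_f)
      then show ?thesis
        using metric_pullback_chart[where g = g, OF A s c, of "chart_inv ?c x" v w] topological_chart_inv(1)[OF top x] by simp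
    qed
    then show "ennreal (sqrt (det (\<chi> i j. g ?c (chart_inv ?c x) (axis i 1) (axis j 1))))
        * indicator (chart_fun ?c ` B) x
      = ennreal (sqrt (det (\<chi> i j. g c (chart_inv c x) (axis i 1) (axis j 1))))
        * indicator (chart_fun c ` s ` B) x"
      by (auto simp: indicator_def image_comp)
  qed
  also have "\<dots> = emeasure \<omega> (s ` B)"
    using vol B c by (auto simp: riemannian_volume_def)
  finally show ?thesis ..
qed

text \<open>\<open>B\<close> is cut into countably many disjoint Borel pieces, each mapped into a
  single chart domain; countable additivity on both sides reduces the claim to these pieces.\<close>

lemma riemannian_volume_isometry:
  fixes A :: "('m::{t2_space, second_countable_topology}, 'n::finite) chart set"
  assumes A: "smooth_manifold A" and vol: "riemannian_volume A g \<omega>"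
    and s: "riemannian_isometry A g s" and B: "B \<in> sets \<omega>"
  shows "emeasure \<omega> (s ` B) = emeasure \<omega> B"
proof -
  let ?t = "inv_into UNIV s"
  have bij: "bij s" and cont: "continuous_on UNIV s" "continuous_on UNIV ?t"
    using s by (auto simp: riemannian_isometry_def diffeomorphism_def smooth_map_def)
  have sets [measurable_cong]: "sets \<omega> = sets borel" using vol by (simp add: riemannian_volume_def)
  have [measurable]: "s \<in> borel_measurable borel" "?t \<in> borel_measurable borel"
    using cont by (auto intro: borel_measurable_continuous_onI)
  have image: "s ` X = ?t -` X" for X
    using bij by (metis bij_imp_bij_inv bij_vimage_eq_inv_image inv_inv_eq)
  have image_sets: "s ` X \<in> sets borel" if "X \<in> sets borel" for X
    using measurable_sets[of ?t borel borel X] that by (simp add: image)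
  \<comment> \<open>Second countability yields a countable subcover by chart domains.\<close>
  obtain \<F> where \<F>: "\<F> \<subseteq> chart_dom ` A" "countable \<F>" "\<Union>\<F> = \<Union>(chart_dom ` A)"
    using A by (rule_tac Lindelof[of "chart_dom ` A"]) (auto simp: smooth_manifold_def topological_chart_def)
  have cover: "\<Union>\<F> = UNIV" using \<F>(3) A by (simp add: smooth_manifold_def)
  then have "\<F> \<noteq> {}" by auto
  \<comment> \<open>Preimages are taken so that the image of each piece lies in one chart. The
    enumeration may repeat sets; \<open>disjointed\<close> turns repetitions into empty
    pieces.\<close>
  define D where "D n = s -` from_nat_into \<F> n" for n
  have D: "\<exists>c\<in>A. D n = s -` chart_dom c" for n
  proof -
    have "from_nat_into \<F> n \<in> chart_dom ` A"
      using from_nat_into[OF \<open>\<F> \<noteq> {}\<close>, of n] \<F>(1) by blast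
    then show ?thesis by (auto simp: D_def)
  qed
  have D_sets: "D n \<in> sets borel" for n
  proof -
    obtain c where c: "c \<in> A" "D n = s -` chart_dom c" using D by blast
    then have "chart_dom c \<in> sets borel"
      using A by (auto simp: smooth_manifold_def topological_chart_def)
    then show ?thesis using measurable_sets[of s borel borel "chart_dom c"] c by simp
  qed
  have "(\<Union>n. D n) = s -` \<Union>(range (from_nat_into \<F>))" by (auto simp: D_def)
  also have "range (from_nat_into \<F>) = \<F>" by (rule range_from_nat_into[OF \<open>\<F> \<noteq> {}\<close> \<F>(2)])
  finally have D_cover: "(\<Union>n. disjointed D n) = UNIV" by (simp add: UN_disjointed_eq cover)
  define P where "P n = B \<inter> disjointed D n" for n
  have B': "B \<in> sets borel" using B sets by simp
  have P_sets: "P n \<in> sets borel" for n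
    using B' sets.range_disjointed_sets'[of D borel] D_sets by (auto simp: P_def)
  have P_disj: "disjoint_family P"
    using disjoint_family_disjointed[of D] by (auto simp: P_def disjoint_family_on_def)
  have P_Un: "(\<Union>n. P n) = B" using D_cover by (auto simp: P_def)
  have P_eq: "emeasure \<omega> (s ` P n) = emeasure \<omega> (P n)" for n
  proof -
    obtain c where c: "c \<in> A" "D n = s -` chart_dom c" using D by blast
    have "s ` P n \<subseteq> chart_dom c" using disjointed_subset[of D n] c by (auto simp: P_def)
    then show ?thesis
      using riemannian_volume_isometry_chart[OF A vol s c(1)] P_sets image_sets by blast
  qed
  have "disjoint_family (\<lambda>n. s ` P n)"
    using P_disj bij_is_inj[OF bij] by (simp add: disjoint_family_on_def flip: image_Int)
  then have "emeasure \<omega> (\<Union>n. s ` P n) = (\<Sum>n. emeasure \<omega> (s ` P n))"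
    using P_sets image_sets by (subst suminf_emeasure) (auto simp: sets)
  also have "\<dots> = emeasure \<omega> (\<Union>n. P n)"
    unfolding P_eq using P_sets P_disj by (subst suminf_emeasure) (auto simp: sets)
  finally show ?thesis by (simp add: P_Un flip: image_UN)
qed

section \<open>Left translations on the group\<close>

lemma left_haar_measure_measurable_mult:
  assumes G: "locally_compact_group G T" and \<mu>: "left_haar_measure G T \<mu>" and a: "a \<in> carrier G"
  shows "mult G a \<in> measurable \<mu> \<mu>"
proof -
  have sets: "sets \<mu> = sigma_sets (carrier G) {U. openin T U}" and space: "space \<mu> = carrier G"
    using \<mu> by (auto simp: left_haar_measure_def)
  interpret group G using G by (simp add: locally_compact_group_def)
  have top: "topspace T = carrier G" using G by (simp add: locally_compact_group_def)
  have "continuous_map T (prod_topology T T) (\<lambda>x. (a, x))"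
    using a top by (intro continuous_map_pairedI) auto
  moreover have "continuous_map (prod_topology T T) T (\<lambda>(x, y). x \<otimes>\<^bsub>G\<^esub> y)"
    using G by (simp add: locally_compact_group_def)
  ultimately have "continuous_map T T ((\<lambda>(x, y). x \<otimes>\<^bsub>G\<^esub> y) \<circ> (\<lambda>x. (a, x)))"
    by (rule continuous_map_compose)
  then have cont: "continuous_map T T (mult G a)" by (simp add: comp_def)
  \<comment> \<open>The open sets generate the sigma-algebra, so continuity of the translation
    settles measurability.\<close>
  have "mult G a \<in> measurable \<mu> (sigma (carrier G) {U. openin T U})"
  proof (rule measurable_measure_of)
    show "{U. openin T U} \<subseteq> Pow (carrier G)" using openin_subset top by fastforce
    show "mult G a \<in> space \<mu> \<rightarrow> carrier G" using a by (auto simp: space)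
    fix U assume "U \<in> {U. openin T U}"
    then have "openin T {x \<in> carrier G. mult G a x \<in> U}"
      using openin_continuous_map_preimage[OF cont] top by auto
    moreover have "mult G a -` U \<inter> space \<mu> = {x \<in> carrier G. mult G a x \<in> U}" by (auto simp: space)
    ultimately show "mult G a -` U \<inter> space \<mu> \<in> sets \<mu>" by (auto simp: sets)
  qed
  moreover have "sets (sigma (carrier G) {U. openin T U}) = sets \<mu>"
    using openin_subset top unfolding sets by (intro sets_measure_of) fastforce
  ultimately show ?thesis by (simp cong: measurable_cong_sets)
qed

section \<open>Functions on the manifold and functions on its isometry group\<close>

theorem theorem5:
  fixes A :: "('m::{t2_space, second_countable_topology}, 'n::finite) chart set"
    and g :: "('m, 'n) chart \<Rightarrow> 'm \<Rightarrow> real ^ 'n \<Rightarrow> real ^ 'n \<Rightarrow> real"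
    and \<omega> :: "'m measure"
    and G :: "('m \<Rightarrow> 'm) monoid"
    and T :: "('m \<Rightarrow> 'm) topology"
    and \<mu> :: "('m \<Rightarrow> 'm) measure"
    and I :: "'i set"
  assumes "smooth_manifold A" and "riemannian_metric A g"
    and "riemannian_volume A g \<omega>"
    and "G = isometry_group A g" and "T = compact_open_topology (carrier G)"
    and transitive: "\<And>x y. \<exists>s\<in>carrier G. s x = y"
    and "locally_compact_group G T"
    and "left_haar_measure G T \<mu>"
  shows "(\<forall>(F :: ('m \<Rightarrow> real) \<Rightarrow> ('m \<Rightarrow> 'm) \<Rightarrow> real)
            (F1 :: 'i \<Rightarrow> ('m \<Rightarrow> real) \<Rightarrow> ('m \<Rightarrow> 'm) \<Rightarrow> real)
            (F2 :: 'i \<Rightarrow> ('m \<Rightarrow> real) \<Rightarrow> ('m \<Rightarrow> 'm) \<Rightarrow> real).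
            F ` L2 \<omega> \<subseteq> L2 \<mu> \<and> equivariant G (\<lambda>s x. s x) \<omega> F \<and>
            (\<forall>i\<in>I. L2_linear \<omega> \<mu> (F1 i) \<and> L2_linear \<omega> \<mu> (F2 i)) \<and>
            (\<forall>i\<in>I. evaluations_bounded \<omega> \<mu> (F1 i) \<and> evaluations_bounded \<omega> \<mu> (F2 i)) \<and>
            (\<forall>f\<in>L2 \<omega>. \<forall>x\<in>carrier G. ((\<lambda>i. F1 i f x * F2 i f x) has_sum F f x) I)
            \<longrightarrow> (\<exists>w. (\<forall>i\<in>I. w i \<in> L2 (\<omega> \<Otimes>\<^sub>M \<omega>)) \<and>
                  (\<forall>f\<in>L2 \<omega>. \<forall>x\<in>carrier G.
                     ((\<lambda>i. correlation2 G (\<lambda>s x. s x) \<omega> f (w i) x) has_sum F f x) I)))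
       \<and> (\<forall>(F :: (('m \<Rightarrow> 'm) \<Rightarrow> real) \<Rightarrow> ('m \<Rightarrow> 'm) \<Rightarrow> real)
            (F1 :: 'i \<Rightarrow> (('m \<Rightarrow> 'm) \<Rightarrow> real) \<Rightarrow> ('m \<Rightarrow> 'm) \<Rightarrow> real)
            (F2 :: 'i \<Rightarrow> (('m \<Rightarrow> 'm) \<Rightarrow> real) \<Rightarrow> ('m \<Rightarrow> 'm) \<Rightarrow> real).
            F ` L2 \<mu> \<subseteq> L2 \<mu> \<and> equivariant G (mult G) \<mu> F \<and>
            (\<forall>i\<in>I. L2_linear \<mu> \<mu> (F1 i) \<and> L2_linear \<mu> \<mu> (F2 i)) \<and>
            (\<forall>i\<in>I. evaluations_bounded \<mu> \<mu> (F1 i) \<and> evaluations_bounded \<mu> \<mu> (F2 i)) \<and>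
            (\<forall>f\<in>L2 \<mu>. \<forall>x\<in>carrier G. ((\<lambda>i. F1 i f x * F2 i f x) has_sum F f x) I)
            \<longrightarrow> (\<exists>w. (\<forall>i\<in>I. w i \<in> L2 (\<mu> \<Otimes>\<^sub>M \<mu>)) \<and>
                  (\<forall>f\<in>L2 \<mu>. \<forall>x\<in>carrier G.
                     ((\<lambda>i. correlation2 G (mult G) \<mu> f (w i) x) has_sum F f x) I)))"
proof -
  have lcg: "group G"
    using \<open>locally_compact_group G T\<close> by (simp add: locally_compact_group_def)
  interpret group G by (rule lcg)
  have space_\<mu>: "space \<mu> = carrier G"
    using \<open>left_haar_measure G T \<mu>\<close> by (simp add: left_haar_measure_def)
  have isometry: "riemannian_isometry A g s" if "s \<in> carrier G" for s
    using that \<open>G = _\<close> by (simp add: isometry_group_def)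
  have mult_G: "s \<otimes>\<^bsub>G\<^esub> t = s \<circ> t" and one_G: "\<one>\<^bsub>G\<^esub> = id" for s t
    using \<open>G = _\<close> by (simp_all add: isometry_group_def)
  have inv_act: "(inv\<^bsub>G\<^esub> s) (s x) = x" "s ((inv\<^bsub>G\<^esub> s) x) = x" if "s \<in> carrier G" for s x
    using l_inv[OF that] r_inv[OF that] by (simp_all add: mult_G one_G fun_eq_iff)
  have sets_\<omega>: "sets \<omega> = sets borel" and space_\<omega>: "space \<omega> = UNIV"
    using \<open>riemannian_volume A g \<omega>\<close> sets_eq_imp_space_eq[of \<omega> borel]
    by (auto simp: riemannian_volume_def)
  have act_\<omega>: "s \<in> measurable \<omega> \<omega>" if "s \<in> carrier G" for s
  proof -
    have "continuous_on UNIV s"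
      using isometry[OF that] by (simp add: riemannian_isometry_def diffeomorphism_def smooth_map_def)
    then show ?thesis
      by (simp add: measurable_cong_sets[OF sets_\<omega> sets_\<omega>] borel_measurable_continuous_onI)
  qed
  \<comment> \<open>Preimages under \<open>s\<close> are images under its group inverse, which is
    again an isometry and preserves volume.\<close>
  have invariant_\<omega>: "distr \<omega> \<omega> s = \<omega>" if s: "s \<in> carrier G" for s
  proof (rule distr_eq_if_emeasure_image[OF act_\<omega>[OF s] act_\<omega>[OF inv_closed[OF s]]])
    show "emeasure \<omega> ((inv\<^bsub>G\<^esub> s) ` B) = emeasure \<omega> B" if "B \<in> sets \<omega>" for B
      by (rule riemannian_volume_isometry[OF \<open>smooth_manifold A\<close> \<open>riemannian_volume A g \<omega>\<close>
            isometry[OF inv_closed[OF s]] that])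
  qed (simp_all add: inv_act[OF s])
  have act_\<mu>: "mult G s \<in> measurable \<mu> \<mu>" if "s \<in> carrier G" for s
    by (rule left_haar_measure_measurable_mult[OF \<open>locally_compact_group G T\<close> \<open>left_haar_measure G T \<mu>\<close> that])
  have inv_mult: "inv\<^bsub>G\<^esub> s \<otimes>\<^bsub>G\<^esub> (s \<otimes>\<^bsub>G\<^esub> x) = x" "s \<otimes>\<^bsub>G\<^esub> (inv\<^bsub>G\<^esub> s \<otimes>\<^bsub>G\<^esub> x) = x"
    if "s \<in> carrier G" "x \<in> carrier G" for s x
    using that by (simp_all flip: m_assoc)
  have invariant_\<mu>: "distr \<mu> \<mu> (mult G s) = \<mu>" if s: "s \<in> carrier G" for s
  proof (rule distr_eq_if_emeasure_image[OF act_\<mu>[OF s] act_\<mu>[OF inv_closed[OF s]]])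
    show "emeasure \<mu> (mult G (inv\<^bsub>G\<^esub> s) ` B) = emeasure \<mu> B" if "B \<in> sets \<mu>" for B
      using \<open>left_haar_measure G T \<mu>\<close> inv_closed[OF s] that unfolding left_haar_measure_def by blast
  qed (simp_all add: space_\<mu> inv_mult s)
  show ?thesis
  proof (intro conjI allI impI; elim conjE)
    \<comment> \<open>The case of the manifold: a group element acts by evaluation.\<close>
    fix F :: "('m \<Rightarrow> real) \<Rightarrow> ('m \<Rightarrow> 'm) \<Rightarrow> real"
      and F1 F2 :: "'i \<Rightarrow> ('m \<Rightarrow> real) \<Rightarrow> ('m \<Rightarrow> 'm) \<Rightarrow> real"
    assume F: "equivariant G (\<lambda>s x. s x) \<omega> F"
      "\<forall>i\<in>I. L2_linear \<omega> \<mu> (F1 i) \<and> L2_linear \<omega> \<mu> (F2 i)"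
      "\<forall>i\<in>I. evaluations_bounded \<omega> \<mu> (F1 i) \<and> evaluations_bounded \<omega> \<mu> (F2 i)"
      "\<forall>f\<in>L2 \<omega>. \<forall>x\<in>carrier G. ((\<lambda>i. F1 i f x * F2 i f x) has_sum F f x) I"
    show "\<exists>w. (\<forall>i\<in>I. w i \<in> L2 (\<omega> \<Otimes>\<^sub>M \<omega>)) \<and> (\<forall>f\<in>L2 \<omega>. \<forall>x\<in>carrier G.
        ((\<lambda>i. correlation2 G (\<lambda>s x. s x) \<omega> f (w i) x) has_sum F f x) I)"
      by (rule second_order_kernels[OF lcg act_\<omega> inv_act(1) invariant_\<omega> space_\<mu> F(1)
            F(2)[rule_format] F(3)[rule_format] F(4)[rule_format]])
  next
    \<comment> \<open>The case of the group: it acts on itself by left multiplication.\<close>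
    fix F :: "(('m \<Rightarrow> 'm) \<Rightarrow> real) \<Rightarrow> ('m \<Rightarrow> 'm) \<Rightarrow> real"
      and F1 F2 :: "'i \<Rightarrow> (('m \<Rightarrow> 'm) \<Rightarrow> real) \<Rightarrow> ('m \<Rightarrow> 'm) \<Rightarrow> real"
    assume F: "equivariant G (mult G) \<mu> F"
      "\<forall>i\<in>I. L2_linear \<mu> \<mu> (F1 i) \<and> L2_linear \<mu> \<mu> (F2 i)"
      "\<forall>i\<in>I. evaluations_bounded \<mu> \<mu> (F1 i) \<and> evaluations_bounded \<mu> \<mu> (F2 i)"
      "\<forall>f\<in>L2 \<mu>. \<forall>x\<in>carrier G. ((\<lambda>i. F1 i f x * F2 i f x) has_sum F f x) I"
    show "\<exists>w. (\<forall>i\<in>I. w i \<in> L2 (\<mu> \<Otimes>\<^sub>M \<mu>)) \<and> (\<forall>f\<in>L2 \<mu>. \<forall>x\<in>carrier G.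
        ((\<lambda>i. correlation2 G (mult G) \<mu> f (w i) x) has_sum F f x) I)"
      by (rule second_order_kernels[OF lcg act_\<mu> inv_mult(1) invariant_\<mu> space_\<mu> F(1)
            F(2)[rule_format] F(3)[rule_format] F(4)[rule_format]]) (simp_all add: space_\<mu>)
  qed
qed

end
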